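(* Let $\mathcal A$ be a unital $C^*$-algebra and let $\mathcal I$ be a non-trivial proper closed two-sided ideal in $\mathcal A$. Let $x$ be a linear extreme point of the closed unit ball $\mathcal A_1$ of $\mathcal A$. Then $\operatorname{dist}(x,\mathcal I)=1$. Moreover, $x+\mathcal I$ is a linear extreme point of the closed unit ball $(\mathcal A/\mathcal I)_1$ of the quotient $C^*$-algebra $\mathcal A/\mathcal I$.
   Context: A linear extreme point is an extreme point in the usual sense of convexity. $\operatorname{dist}(x,\mathcal I)=\inf_{y\in\mathcal I}\|x-y\|$. *)

theory Defs
  imports "HOL-Analysis.Analysis"
begin

text \<open>
  Unital complex C*-algebras as a type class.  The superclass \<^class>\<open>real_normed_algebra_1\<close>
  contributes submultiplicativity of the norm and \<open>norm 1 = 1\<close>; the latter excludes only the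
  zero algebra, which has no non-trivial ideal.  The complex scalar multiplication extends the
  real one of the superclass.
\<close>

class unital_cstar_algebra = real_normed_algebra_1 + banach +
  fixes scaleC :: "complex \<Rightarrow> 'a \<Rightarrow> 'a"
    and star :: "'a \<Rightarrow> 'a"
  assumes scaleC_of_real: "scaleC (complex_of_real r) a = scaleR r a"
    and scaleC_add_right: "scaleC c (a + b) = scaleC c a + scaleC c b"
    and scaleC_add_left: "scaleC (c + d) a = scaleC c a + scaleC d a"
    and scaleC_scaleC: "scaleC c (scaleC d a) = scaleC (c * d) a"
    and mult_scaleC_left: "scaleC c a * b = scaleC c (a * b)"
    and mult_scaleC_right: "a * scaleC c b = scaleC c (a * b)"
    and norm_scaleC: "norm (scaleC c a) = cmod c * norm a"
    and star_add: "star (a + b) = star a + star b"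
    and star_scaleC: "star (scaleC c a) = scaleC (cnj c) (star a)"
    and star_mult: "star (a * b) = star b * star a"
    and star_star: "star (star a) = a"
    and norm_star_mult: "norm (star a * a) = (norm a)\<^sup>2"

instantiation complex :: unital_cstar_algebra
begin

definition "scaleC_complex = (\<lambda>c z :: complex. c * z)"
definition "star_complex = cnj"

instance
  by standard
    (auto simp: scaleC_complex_def star_complex_def scaleR_conv_of_real algebra_simps norm_mult
      power2_eq_square)

end

definition two_sided_ideal :: "'a::unital_cstar_algebra set \<Rightarrow> bool" where
  "two_sided_ideal I \<longleftrightarrow>
     0 \<in> I \<and> (\<forall>a\<in>I. \<forall>b\<in>I. a + b \<in> I) \<and> (\<forall>c. \<forall>a\<in>I. scaleC c a \<in> I) \<and>
     (\<forall>r. \<forall>a\<in>I. r * a \<in> I \<and> a * r \<in> I)"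

text \<open>
  The quotient by an ideal depends on a set of elements, so it cannot be a type of its own.  It is
  a record of operations on cosets.
\<close>

record 'b star_alg =
  sa_carrier :: "'b set"
  sa_zero :: 'b
  sa_one :: 'b
  sa_add :: "'b \<Rightarrow> 'b \<Rightarrow> 'b"
  sa_mult :: "'b \<Rightarrow> 'b \<Rightarrow> 'b"
  sa_scale :: "complex \<Rightarrow> 'b \<Rightarrow> 'b"
  sa_star :: "'b \<Rightarrow> 'b"
  sa_norm :: "'b \<Rightarrow> real"

definition closed_unit_ball :: "'b star_alg \<Rightarrow> 'b set" where
  "closed_unit_ball A = {a \<in> sa_carrier A. sa_norm A a \<le> 1}"

definition linear_extreme_point :: "'b star_alg \<Rightarrow> 'b \<Rightarrow> 'b set \<Rightarrow> bool" where
  "linear_extreme_point A e S \<longleftrightarrow>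
     e \<in> S \<and>
     (\<forall>a\<in>S. \<forall>b\<in>S. \<forall>t::real. 0 < t \<and> t < 1 \<and>
        e = sa_add A (sa_scale A (complex_of_real (1 - t)) a) (sa_scale A (complex_of_real t) b)
        \<longrightarrow> a = e \<and> b = e)"

definition coset :: "'a::unital_cstar_algebra set \<Rightarrow> 'a \<Rightarrow> 'a set" where
  "coset I a = (\<lambda>i. a + i) ` I"

text \<open>
  Each operation takes the union of the cosets of all results obtained from representatives; for
  the ideals in question this union is a single coset.  For the involution this uses that closed
  two-sided ideals of C*-algebras are self-adjoint.
\<close>

definition quotient_alg :: "'a::unital_cstar_algebra set \<Rightarrow> 'a set star_alg" where
  "quotient_alg I = \<lparr>
     sa_carrier = range (coset I),
     sa_zero = coset I 0,
     sa_one = coset I 1,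
     sa_add = (\<lambda>X Y. \<Union>a\<in>X. \<Union>b\<in>Y. coset I (a + b)),
     sa_mult = (\<lambda>X Y. \<Union>a\<in>X. \<Union>b\<in>Y. coset I (a * b)),
     sa_scale = (\<lambda>c X. \<Union>a\<in>X. coset I (scaleC c a)),
     sa_star = (\<lambda>X. \<Union>a\<in>X. coset I (star a)),
     sa_norm = (\<lambda>X. INF a\<in>X. norm a)\<rparr>"

lemma scaleC_minus_one: "scaleC (- 1) a = - (a :: 'a::unital_cstar_algebra)"
  using scaleC_of_real[of "- 1" a] by simp

lemma two_sided_ideal_diff:
  assumes "two_sided_ideal I" "a \<in> I" "b \<in> I"
  shows "a - b \<in> I"
proof -
  have "scaleC (- 1) b \<in> I"
    using assms unfolding two_sided_ideal_def by blast
  then have "a + - b \<in> I"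
    using assms unfolding scaleC_minus_one two_sided_ideal_def by blast
  then show ?thesis by simp
qed

lemma mem_coset_iff: "b \<in> coset I a \<longleftrightarrow> b - a \<in> I"
  unfolding coset_def by (auto simp: image_iff) (metis add.commute diff_add_cancel)

lemma coset_eq_iff:
  assumes I: "two_sided_ideal I"
  shows "coset I a = coset I b \<longleftrightarrow> a - b \<in> I"
proof
  assume "coset I a = coset I b"
  moreover have "a \<in> coset I a"
    using I by (simp add: mem_coset_iff two_sided_ideal_def)
  ultimately show "a - b \<in> I"
    by (simp add: mem_coset_iff)
next
  assume ab: "a - b \<in> I"
  have "c - a \<in> I \<longleftrightarrow> c - b \<in> I" for c
  proof
    assume "c - a \<in> I"
    then have "(c - a) + (a - b) \<in> I"
      using I ab unfolding two_sided_ideal_def by blast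
    then show "c - b \<in> I" by simp
  next
    assume "c - b \<in> I"
    then have "(c - b) - (a - b) \<in> I"
      using two_sided_ideal_diff[OF I] ab by blast
    then show "c - a \<in> I" by simp
  qed
  then show "coset I a = coset I b"
    by (auto simp: mem_coset_iff)
qed

lemma UN_coset_eq:
  assumes "two_sided_ideal I" and "\<And>b. b \<in> coset I a \<Longrightarrow> coset I (f b) = coset I (f a)"
  shows "(\<Union>b\<in>coset I a. coset I (f b)) = coset I (f a)"
proof -
  have "a \<in> coset I a"
    using assms(1) by (simp add: mem_coset_iff two_sided_ideal_def)
  then show ?thesis using assms(2) by blast
qed

lemma UN_UN_coset_eq:
  assumes I: "two_sided_ideal I"
    and f: "\<And>c d. c - a \<in> I \<Longrightarrow> d - b \<in> I \<Longrightarrow> f c d - f a b \<in> I"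
  shows "(\<Union>c\<in>coset I a. \<Union>d\<in>coset I b. coset I (f c d)) = coset I (f a b)"
proof -
  have "coset I (f c d) = coset I (f a b)" if "c \<in> coset I a" "d \<in> coset I b" for c d
    using that f by (simp add: coset_eq_iff[OF I] mem_coset_iff)
  moreover have "a \<in> coset I a" "b \<in> coset I b"
    using I by (simp_all add: mem_coset_iff two_sided_ideal_def)
  ultimately show ?thesis by blast
qed

lemma quotient_add:
  assumes I: "two_sided_ideal I"
  shows "sa_add (quotient_alg I) (coset I a) (coset I b) = coset I (a + b)"
proof -
  have "(c + d) - (a + b) \<in> I" if "c - a \<in> I" "d - b \<in> I" for c d
  proof -
    have "(c - a) + (d - b) \<in> I"
      using that I unfolding two_sided_ideal_def by blast
    then show ?thesis by (simp add: algebra_simps)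
  qed
  then show ?thesis
    by (simp add: quotient_alg_def UN_UN_coset_eq[OF I, where f = "(+)"])
qed

lemma quotient_mult:
  assumes I: "two_sided_ideal I"
  shows "sa_mult (quotient_alg I) (coset I a) (coset I b) = coset I (a * b)"
proof -
  have "c * d - a * b \<in> I" if "c - a \<in> I" "d - b \<in> I" for c d
  proof -
    have "(c - a) * d \<in> I" "a * (d - b) \<in> I"
      using that I unfolding two_sided_ideal_def by blast+
    then have "(c - a) * d + a * (d - b) \<in> I"
      using I unfolding two_sided_ideal_def by blast
    then show ?thesis by (simp add: algebra_simps)
  qed
  then show ?thesis
    by (simp add: quotient_alg_def UN_UN_coset_eq[OF I, where f = "(*)"])
qed

lemma quotient_scale:
  assumes I: "two_sided_ideal I"
  shows "sa_scale (quotient_alg I) c (coset I a) = coset I (scaleC c a)"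
proof -
  have "coset I (scaleC c b) = coset I (scaleC c a)" if "b \<in> coset I a" for b
  proof -
    have "scaleC c (b - a) \<in> I"
      using that I unfolding two_sided_ideal_def mem_coset_iff by blast
    moreover have "scaleC c b = scaleC c (b - a) + scaleC c a"
      by (simp flip: scaleC_add_right)
    ultimately show ?thesis by (simp add: coset_eq_iff[OF I])
  qed
  then show ?thesis
    using UN_coset_eq[OF I, of a "scaleC c"] by (simp add: quotient_alg_def)
qed

lemma quotient_norm:
  assumes I: "two_sided_ideal I"
  shows "sa_norm (quotient_alg I) (coset I a) = infdist a I"
proof -
  have "(\<lambda>i. dist a i) ` I = norm ` coset I a"
  proof -
    have "(\<lambda>i. dist a i) ` I = (\<lambda>i. norm (a + i)) ` uminus ` I"
      by (simp add: image_image dist_norm)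
    also have "uminus ` I = I"
      using two_sided_ideal_diff[OF I, of 0] I
      by (force simp: two_sided_ideal_def image_iff)
    finally show ?thesis by (simp add: coset_def image_image)
  qed
  moreover have "I \<noteq> {}"
    using I by (auto simp: two_sided_ideal_def)
  ultimately show ?thesis by (simp add: quotient_alg_def infdist_def)
qed

definition type_alg :: "'a::unital_cstar_algebra star_alg" where
  "type_alg = \<lparr>sa_carrier = UNIV, sa_zero = 0, sa_one = 1, sa_add = (+), sa_mult = (*),
     sa_scale = scaleC, sa_star = star, sa_norm = norm\<rparr>"

lemma linear_extreme_point_type_alg:
  "linear_extreme_point type_alg e S \<longleftrightarrow> e extreme_point_of S"
proof -
  have "linear_extreme_point type_alg e S \<longleftrightarrow> e \<in> S \<and>
     (\<forall>a\<in>S. \<forall>b\<in>S. \<forall>t::real. 0 < t \<and> t < 1 \<and> e = (1 - t) *\<^sub>R a + t *\<^sub>R b \<longrightarrow> a = e \<and> b = e)"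
    unfolding linear_extreme_point_def type_alg_def by (simp only: star_alg.simps scaleC_of_real)
  also have "\<dots> \<longleftrightarrow> e extreme_point_of S"
  proof -
    have "a = e \<and> b = e \<longleftrightarrow> a = b" if "0 < t" "t < 1" "e = (1 - t) *\<^sub>R a + t *\<^sub>R b"
      for a b and t :: real
    proof -
      have "e - a = t *\<^sub>R (b - a)"
        using that(3) by (simp add: algebra_simps)
      then show ?thesis using that(1) by auto
    qed
    then show ?thesis
      unfolding extreme_point_of_def in_segment by blast
  qed
  finally show ?thesis .
qed

lemma closed_unit_ball_type_alg: "closed_unit_ball type_alg = cball 0 1"
  by (auto simp: closed_unit_ball_def type_alg_def)

end

theory Submission
  imports Defs
begin

text \<open>
  An extreme point \<open>x\<close> of the unit ball is a partial isometry with
  \<open>(1 - x x\<^sup>*) \<A> (1 - x\<^sup>* x) = 0\<close> (Kadison), and this algebraic condition passes to the quotient,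
  where it forces extremality again.  The second half is carried out in \<open>\<A>\<close> itself, with the
  seminorm \<open>infdist _ I\<close>: approximate units \<open>1 - (1 - k) ^ n\<close> for \<open>0 \<le> k \<in> I\<close> turn operator
  inequalities modulo \<open>I\<close> into bounds on this seminorm.  Instead of spectral theory, positive
  elements are treated as squares of self-adjoint ones, the only analytic input being the binomial
  series of \<open>sqrt (1 - k)\<close>.
\<close>

section \<open>The involution\<close>

lemma star_scaleR: "star (r *\<^sub>R a) = r *\<^sub>R star (a :: 'a::unital_cstar_algebra)"
  using star_scaleC[of "complex_of_real r" a] by (simp add: scaleC_of_real)

lemma star_zero [simp]: "star (0 :: 'a::unital_cstar_algebra) = 0"
  using star_scaleR[of 0 "0 :: 'a"] by simp

lemma star_minus: "star (- a) = - star (a :: 'a::unital_cstar_algebra)"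
  using star_scaleR[of "- 1" a] by simp

lemma star_diff: "star (a - b) = star a - star (b :: 'a::unital_cstar_algebra)"
  using star_add[of a "- b"] by (simp add: star_minus)

lemma star_one [simp]: "star (1 :: 'a::unital_cstar_algebra) = 1"
  by (metis mult.left_neutral mult.right_neutral star_mult star_star)

lemma star_power: "star (a ^ n) = star (a :: 'a::unital_cstar_algebra) ^ n"
  by (induction n) (simp_all add: star_mult power_commutes)

lemmas star_simps = star_add star_diff star_minus star_mult star_scaleR star_star star_power

lemma norm_star [simp]: "norm (star a) = norm (a :: 'a::unital_cstar_algebra)"
proof -
  have le: "norm b \<le> norm (star b)" for b :: 'a
  proof (cases "b = 0")
    case False
    have "norm b * norm b \<le> norm (star b) * norm b"
      using norm_mult_ineq[of "star b" b] by (simp add: norm_star_mult power2_eq_square)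
    then show ?thesis using False by simp
  qed simp
  from le[of a] le[of "star a"] show ?thesis by (simp add: star_star)
qed

lemma bounded_linear_star: "bounded_linear (star :: 'a::unital_cstar_algebra \<Rightarrow> 'a)"
  by (rule bounded_linear_intro[where K = 1]) (simp_all add: star_add star_scaleR)

lemma norm_selfadjoint_square:
  "star a = a \<Longrightarrow> norm (a * a) = (norm (a :: 'a::unital_cstar_algebra))\<^sup>2"
  by (metis norm_star_mult)

lemma selfadjoint_square_eq_0D:
  "star a = a \<Longrightarrow> a * a = 0 \<Longrightarrow> (a :: 'a::unital_cstar_algebra) = 0"
  using norm_selfadjoint_square[of a] by simp

section \<open>Square roots\<close>

lemma minus_one_power_gbinomial:
  "(- 1) ^ n * ((a :: real) gchoose n) = pochhammer (- a) n / fact n"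
  by (simp add: gbinomial_pochhammer)

text \<open>Of the factors of \<open>pochhammer (- 1/2) (Suc n)\<close> only the first,
  \<open>- 1/2\<close>, is negative.\<close>

lemma half_binomial_coeff_nonpos: "(- 1) ^ Suc n * ((1/2 :: real) gchoose Suc n) \<le> 0"
  unfolding minus_one_power_gbinomial pochhammer_rec
  by (simp add: divide_nonneg_pos pochhammer_nonneg)

text \<open>The signed coefficients up to \<open>n\<close> add up to
  \<open>(- 1) ^ n * (- 1/2 gchoose n)\<close>, which is nonnegative; so the nonpositive ones after
  the leading 1 consume at most that 1.\<close>

lemma half_binomial_coeff_partial_sums:
  "(\<Sum>i<n. \<bar>(- 1) ^ Suc i * ((1/2 :: real) gchoose Suc i)\<bar>) \<le> 1"
proof -
  have "(\<Sum>i\<le>n. (- 1) ^ i * ((1/2 :: real) gchoose i)) = (- 1) ^ n * (- 1/2 gchoose n)"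
    using gbinomial_sum_lower_neg[of "1/2 :: real" n] by (simp add: mult.commute)
  also have "\<dots> \<ge> 0"
    unfolding minus_one_power_gbinomial by (simp add: pochhammer_nonneg)
  finally have "0 \<le> 1 + (\<Sum>i<n. (- 1) ^ Suc i * ((1/2 :: real) gchoose Suc i))"
    by (simp add: sum.atMost_shift)
  moreover have "(\<Sum>i<n. \<bar>(- 1) ^ Suc i * ((1/2 :: real) gchoose Suc i)\<bar>)
      = - (\<Sum>i<n. (- 1) ^ Suc i * ((1/2 :: real) gchoose Suc i))"
    unfolding sum_negf[symmetric]
    by (rule sum.cong[OF refl]) (use half_binomial_coeff_nonpos in \<open>simp only: abs_of_nonpos\<close>)
  ultimately show ?thesis by linarith
qed

text \<open>Vandermonde's identity for \<open>1/2 + 1/2 = 1\<close>: squaring the series of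
  \<open>sqrt (1 - k)\<close> leaves the coefficients of \<open>1 - k\<close>.\<close>

lemma half_binomial_convolution:
  "(\<Sum>i\<le>n. ((- 1) ^ i * ((1/2 :: real) gchoose i)) * ((- 1) ^ (n - i) * (1/2 gchoose (n - i))))
    = (- 1) ^ n * real (1 choose n)"
proof -
  have "(- 1) ^ n * real (1 choose n) = (- 1) ^ n * ((1/2 + 1/2 :: real) gchoose n)"
    by (simp add: binomial_gbinomial)
  also have "\<dots> = (\<Sum>i\<le>n. (- 1) ^ n * ((1/2 gchoose i) * (1/2 gchoose (n - i))))"
    by (subst gbinomial_Vandermonde[symmetric]) (simp add: sum_distrib_left atLeast0AtMost)
  also have "\<dots> = (\<Sum>i\<le>n. ((- 1) ^ i * ((1/2 :: real) gchoose i))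
      * ((- 1) ^ (n - i) * (1/2 gchoose (n - i))))"
  proof (rule sum.cong[OF refl])
    fix i assume "i \<in> {..n}"
    then have "(- 1 :: real) ^ n = (- 1) ^ i * (- 1) ^ (n - i)"
      by (simp flip: power_add)
    then show "(- 1) ^ n * ((1/2 gchoose i) * (1/2 gchoose (n - i)))
      = ((- 1) ^ i * ((1/2 :: real) gchoose i)) * ((- 1) ^ (n - i) * (1/2 gchoose (n - i)))"
      by simp
  qed
  finally show ?thesis ..
qed

text \<open>
  The binomial series of \<open>sqrt (1 - k)\<close> converges absolutely even for \<open>norm k = 1\<close>, because its
  coefficients after the first are nonpositive with sum at least \<open>- 1\<close>.
\<close>

lemma ex_sqrt_one_minus:
  fixes k :: "'a::unital_cstar_algebra"
  assumes sa: "star k = k" and le: "norm k \<le> 1"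
  obtains s where "star s = s" "s * s = 1 - k" "norm (1 - s) \<le> 1"
    "\<And>b. b * k = k * b \<Longrightarrow> b * s = s * b"
proof -
  define c :: "nat \<Rightarrow> real" where "c n = (- 1) ^ n * (1/2 gchoose n)" for n
  define f where "f n = c n *\<^sub>R k ^ n" for n
  have c0: "c 0 = 1" by (simp add: c_def)
  have partial: "(\<Sum>i<n. \<bar>c (Suc i)\<bar>) \<le> 1" for n
    unfolding c_def by (rule half_binomial_coeff_partial_sums)
  have sumc: "summable (\<lambda>n. \<bar>c (Suc n)\<bar>)"
    by (rule summableI_nonneg_bounded[OF _ partial]) simp
  have norm_f: "norm (f n) \<le> \<bar>c n\<bar>" for n
  proof -
    have "norm (k ^ n) \<le> 1"
      using norm_power_ineq[of k n] power_le_one[OF norm_ge_zero le, of n] by linarith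
    then show ?thesis by (simp add: f_def mult_left_le)
  qed
  have snf: "summable (\<lambda>n. norm (f n))"
    by (rule summable_comparison_test'[where N = 0 and g = "\<lambda>n. \<bar>c n\<bar>"])
      (use sumc norm_f in \<open>simp_all add: summable_Suc_iff[of "\<lambda>n. \<bar>c n\<bar>"]\<close>)
  then have sf: "summable f" by (rule summable_norm_cancel)
  define s where "s = suminf f"
  have "star s = (\<Sum>n. star (f n))"
    unfolding s_def by (rule bounded_linear.suminf[OF bounded_linear_star sf])
  then have 1: "star s = s"
    by (simp add: s_def f_def[abs_def] star_simps sa)
  have "(\<lambda>n. \<Sum>i\<le>n. f i * f (n - i)) sums (s * s)"
    unfolding s_def by (rule Cauchy_product_sums[OF snf snf])
  moreover have "(\<Sum>i\<le>n. f i * f (n - i)) = ((- 1) ^ n * real (1 choose n)) *\<^sub>R k ^ n" for n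
  proof -
    have "(\<Sum>i\<le>n. f i * f (n - i)) = (\<Sum>i\<le>n. (c i * c (n - i)) *\<^sub>R k ^ n)"
      by (rule sum.cong[OF refl]) (auto simp: f_def mult_ac simp flip: power_add)
    also have "\<dots> = (\<Sum>i\<le>n. c i * c (n - i)) *\<^sub>R k ^ n"
      by (rule scaleR_sum_left[symmetric])
    finally show ?thesis
      unfolding c_def half_binomial_convolution .
  qed
  ultimately have "(\<lambda>n. ((- 1) ^ n * real (1 choose n)) *\<^sub>R k ^ n) sums (s * s)"
    by simp
  moreover have "(\<lambda>n. ((- 1) ^ n * real (1 choose n)) *\<^sub>R k ^ n) sums
      (\<Sum>n\<in>{0,1}. ((- 1) ^ n * real (1 choose n)) *\<^sub>R k ^ n)"
    by (rule sums_finite) (auto simp: binomial_eq_0)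
  ultimately have 2: "s * s = 1 - k"
    by (auto dest: sums_unique2)
  have "s = f 0 + (\<Sum>n. f (Suc n))"
    unfolding s_def using suminf_split_head[OF sf] by simp
  then have "norm (1 - s) = norm (\<Sum>n. f (Suc n))"
    by (simp add: f_def c0)
  also have "\<dots> \<le> (\<Sum>n. \<bar>c (Suc n)\<bar>)"
    by (rule norm_suminf_le[OF norm_f sumc])
  also have "\<dots> \<le> 1"
    by (rule suminf_le_const[OF sumc partial])
  finally have 3: "norm (1 - s) \<le> 1" .
  have 4: "b * s = s * b" if "b * k = k * b" for b
  proof -
    have "b * k ^ n = k ^ n * b" for n
      using power_commuting_commutes[of k b n] that by simp
    then show ?thesis
      unfolding s_def suminf_mult[OF sf, symmetric] suminf_mult2[OF sf] by (simp add: f_def)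
  qed
  from that[OF 1 2 3 4] show ?thesis .
qed

text \<open>Here \<open>a + i b\<close> is normal with modulus constantly \<open>sqrt C\<close>.\<close>

lemma norm_le_of_sum_squares:
  fixes a b :: "'a::unital_cstar_algebra"
  assumes sa: "star a = a" "star b = b" and comm: "a * b = b * a"
    and sq: "a * a + b * b = of_real C" and C: "0 \<le> C"
  shows "(norm a)\<^sup>2 \<le> C"
proof -
  have neg: "scaleC (- c) d = - scaleC c d" for c and d :: 'a
    using scaleC_scaleC[of "- 1" c d] by (simp add: scaleC_minus_one)
  have diff: "scaleC c (d - e) = scaleC c d - scaleC c e" for c and d e :: 'a
    by (metis add_diff_cancel diff_add_cancel scaleC_add_right)
  define u where "u = a + scaleC \<i> b"
  have su: "star u = a - scaleC \<i> b"
    by (simp add: u_def star_add star_scaleC sa neg)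
  have "star u * u = a * a + b * b"
    unfolding su unfolding u_def using scaleC_of_real[of "1" "b * b"]
    by (simp add: algebra_simps mult_scaleC_left mult_scaleC_right scaleC_scaleC comm
        scaleC_minus_one diff)
  then have nu: "(norm u)\<^sup>2 = C"
    using norm_star_mult[of u] C by (simp add: sq)
  have "u + star u = 2 *\<^sub>R a"
    unfolding su by (simp add: u_def scaleR_2)
  then have "2 * norm a \<le> norm u + norm (star u)"
    using norm_triangle_ineq[of u "star u"] by simp
  then have "norm a \<le> norm u" by simp
  then show ?thesis
    using nu power_mono[of "norm a" "norm u" 2] by simp
qed

text \<open>The square root \<open>s\<close> of \<open>1 - a * a\<close> commutes with
  \<open>a\<close>, and \<open>s * s + a * a = 1\<close>, so \<open>norm_le_of_sum_squares\<close>
  bounds \<open>norm s\<close> by 1.\<close>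

lemma norm_one_minus_square_le:
  fixes a :: "'a::unital_cstar_algebra"
  assumes sa: "star a = a" and le: "norm a \<le> 1"
  shows "norm (1 - a * a) \<le> 1"
proof -
  have "norm (a * a) \<le> 1"
    using le by (simp add: norm_selfadjoint_square[OF sa] power_le_one)
  then obtain s where s: "star s = s" "s * s = 1 - a * a"
      "\<And>b. b * (a * a) = (a * a) * b \<Longrightarrow> b * s = s * b"
    using ex_sqrt_one_minus[of "a * a"] star_mult[of a a] unfolding sa by metis
  have "(norm s)\<^sup>2 \<le> 1"
    using norm_le_of_sum_squares[of s a 1] s(1,2) s(3)[of a] sa by (simp add: mult.assoc)
  then show ?thesis
    using norm_selfadjoint_square[OF s(1)] s(2) by simp
qed

section \<open>Positive elements\<close>

definition pos :: "'a::unital_cstar_algebra \<Rightarrow> bool" where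
  "pos h \<longleftrightarrow> (\<exists>a. star a = a \<and> h = a * a)"

lemma pos_square: "star a = a \<Longrightarrow> pos (a * a)"
  unfolding pos_def by blast

lemma pos_selfadjoint: "pos h \<Longrightarrow> star h = h"
  unfolding pos_def by (auto simp: star_simps)

text \<open>Dividing by \<open>t\<close> reduces this to \<open>norm_one_minus_square_le\<close>.
  Together with its converse \<open>posI_norm\<close> it replaces the spectrum: a self-adjoint
  element is positive when it lies in a ball of radius \<open>t\<close> around
  \<open>t\<close>.\<close>

lemma pos_norm_diff_le:
  assumes "pos h" "norm h \<le> t"
  shows "norm (of_real t - h) \<le> t"
proof (cases "t = 0")
  case False
  then have t: "t > 0" using assms(2) norm_ge_zero[of h] by linarith
  obtain a where a: "star a = a" "h = a * a"
    using assms(1) unfolding pos_def by blast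
  define b where "b = (1 / sqrt t) *\<^sub>R a"
  have b: "star b = b" by (simp add: b_def star_simps a)
  have bb: "b * b = (1 / t) *\<^sub>R h" using t by (simp add: b_def a)
  have "(norm b)\<^sup>2 \<le> 1"
    using norm_selfadjoint_square[OF b] assms(2) t by (simp add: bb divide_simps)
  then have "norm (1 - b * b) \<le> 1"
    using norm_one_minus_square_le[OF b] by (simp add: power_le_one_iff)
  moreover have "of_real t - h = t *\<^sub>R (1 - b * b)"
    using t by (simp add: bb algebra_simps of_real_def)
  ultimately show ?thesis using t by (simp add: mult_left_le)
qed (use assms in simp)

text \<open>For \<open>t > 0\<close> the root is \<open>sqrt t\<close> times that of
  \<open>1 - k\<close>, where \<open>k = 1 - h / t\<close> has norm at most 1. The bound on
  \<open>of_real (sqrt t) - s\<close> makes the root itself positive, by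
  \<open>posI_norm\<close>.\<close>

lemma ex_pos_sqrt_of_norm_diff_le:
  assumes sa: "star h = h" and le: "norm (of_real t - h) \<le> t"
  obtains s where "star s = s" "s * s = h" "norm (of_real (sqrt t) - s) \<le> sqrt t"
    "\<And>b. b * h = h * b \<Longrightarrow> b * s = s * b"
proof (cases "t = 0")
  case True
  then show ?thesis using le that[of 0] by simp
next
  case False
  then have t: "t > 0" using le norm_ge_zero[of "of_real t - h"] by linarith
  define k where "k = (1 / t) *\<^sub>R (of_real t - h)"
  have k: "k = 1 - (1 / t) *\<^sub>R h"
    using t by (simp add: k_def of_real_def algebra_simps)
  have "star k = k" by (simp add: k star_simps sa)
  moreover have "norm k \<le> 1" using le t by (simp add: k_def divide_simps)
  ultimately obtain s where s: "star s = s" "s * s = 1 - k" "norm (1 - s) \<le> 1"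
    "\<And>b. b * k = k * b \<Longrightarrow> b * s = s * b"
    using ex_sqrt_one_minus by blast
  show ?thesis
  proof (rule that[of "sqrt t *\<^sub>R s"])
    show "star (sqrt t *\<^sub>R s) = sqrt t *\<^sub>R s" by (simp add: star_simps s)
    show "(sqrt t *\<^sub>R s) * (sqrt t *\<^sub>R s) = h" using t by (simp add: s k)
    have "of_real (sqrt t) - sqrt t *\<^sub>R s = sqrt t *\<^sub>R (1 - s)"
      by (simp add: of_real_def algebra_simps)
    then show "norm (of_real (sqrt t) - sqrt t *\<^sub>R s) \<le> sqrt t"
      using s(3) t by (simp add: mult_left_le)
    show "b * (sqrt t *\<^sub>R s) = sqrt t *\<^sub>R s * b" if "b * h = h * b" for b
      using s(4)[of b] that by (simp add: k algebra_simps)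
  qed
qed

lemma posI_norm:
  assumes "star h = h" "norm (of_real t - h) \<le> t"
  shows "pos h"
  using ex_pos_sqrt_of_norm_diff_le[OF assms] unfolding pos_def by metis

lemma ex_pos_sqrt:
  assumes "pos h"
  obtains s where "pos s" "star s = s" "s * s = h" "\<And>b. b * h = h * b \<Longrightarrow> b * s = s * b"
  using ex_pos_sqrt_of_norm_diff_le[OF pos_selfadjoint pos_norm_diff_le, OF assms assms order.refl]
    posI_norm by metis

text \<open>Sums are not visibly squares, but the triangle inequality carries the ball criterion of
  \<open>posI_norm\<close> over to them.\<close>

lemma pos_add:
  assumes "pos h" "pos k"
  shows "pos (h + k)"
proof (rule posI_norm[where t = "norm h + norm k"])
  show "star (h + k) = h + k"
    using assms by (simp add: star_add pos_selfadjoint)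
  have "of_real (norm h + norm k) - (h + k)
      = (of_real (norm h) - h) + (of_real (norm k) - k)"
    by simp
  then show "norm (of_real (norm h + norm k) - (h + k)) \<le> norm h + norm k"
    unfolding \<open>of_real (norm h + norm k) - (h + k) = _\<close>
    using norm_triangle_mono[OF pos_norm_diff_le[OF assms(1) order.refl]
        pos_norm_diff_le[OF assms(2) order.refl]] by simp
qed

lemma pos_scaleR:
  assumes "pos h" "0 \<le> r"
  shows "pos (r *\<^sub>R h)"
proof -
  obtain a where "star a = a" "h = a * a" using assms(1) unfolding pos_def by blast
  then show ?thesis
    using pos_square[of "sqrt r *\<^sub>R a"] assms(2) by (simp add: star_simps)
qed

lemma pos_one [simp]: "pos 1"
  using pos_square[of 1] by simp

lemma pos_zero [simp]: "pos 0"
  using pos_square[of 0] by simp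

text \<open>The commutation clause of \<open>ex_pos_sqrt\<close>, used once for each root, makes
  \<open>s\<close> and \<open>r\<close> commute; then \<open>s * r\<close> is a self-adjoint root of
  \<open>h * k\<close>.\<close>

lemma pos_mult:
  assumes "pos h" "pos k" "h * k = k * h"
  shows "pos (h * k)"
proof -
  obtain s where s: "star s = s" "s * s = h" "\<And>b. b * h = h * b \<Longrightarrow> b * s = s * b"
    using ex_pos_sqrt[OF assms(1)] by metis
  obtain r where r: "star r = r" "r * r = k" "\<And>b. b * k = k * b \<Longrightarrow> b * r = r * b"
    using ex_pos_sqrt[OF assms(2)] by metis
  have "k * s = s * k" using s(3) assms(3) by metis
  then have sr: "s * r = r * s" using r(3) by metis
  have "(s * r) * (s * r) = s * (r * s) * r" by (simp add: mult.assoc)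
  also have "\<dots> = h * k" by (simp add: sr[symmetric] mult.assoc flip: s(2) r(2))
  finally show ?thesis
    using pos_square[of "s * r"] by (simp add: star_simps s r sr)
qed

lemma pos_power: "pos h \<Longrightarrow> pos (h ^ n)"
  by (induction n) (simp_all add: pos_mult power_commutes)

text \<open>Roots of \<open>h\<close> and of \<open>of_real C - h\<close> commute and their squares
  add up to \<open>C\<close>, which is the situation of
  \<open>norm_le_of_sum_squares\<close>.\<close>

lemma pos_norm_le:
  assumes h: "pos h" and d: "pos (of_real C - h)" and C: "0 \<le> C"
  shows "norm h \<le> C"
proof -
  obtain s where s: "star s = s" "s * s = h"
    using h unfolding pos_def by metis
  obtain r where r: "star r = r" "r * r = of_real C - h"
      "\<And>b. b * (of_real C - h) = (of_real C - h) * b \<Longrightarrow> b * r = r * b"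
    using ex_pos_sqrt[OF d] by metis
  have "s * (of_real C - h) = (of_real C - h) * s"
    by (simp add: of_real_def algebra_simps flip: s(2))
  then have "s * r = r * s" by (rule r(3))
  then have "(norm s)\<^sup>2 \<le> C"
    using norm_le_of_sum_squares[of s r C] s r(1,2) C by simp
  then show ?thesis using norm_selfadjoint_square[OF s(1)] s(2) by simp
qed

lemma pos_of_norm_le:
  assumes "star h = h" "norm h \<le> C"
  shows "pos (of_real C - h)"
  by (rule posI_norm[where t = C]) (use assms in \<open>simp_all add: star_simps of_real_def\<close>)

text \<open>Bernoulli's inequality in the operator order. From \<open>n\<close> to
  \<open>n + 1\<close> the defect \<open>D\<close> becomes
  \<open>D * (1 + c) + n * c\<^sup>2\<close>, built from commuting positive elements.\<close>

lemma pos_one_plus_power_diff: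
  assumes "pos c"
  shows "pos ((1 + c) ^ n - 1 - real n *\<^sub>R c)"
proof (induction n)
  case (Suc n)
  define D where "D = (1 + c) ^ n - 1 - real n *\<^sub>R c"
  have "D * (1 + c) = (1 + c) * D"
    using power_commuting_commutes[of "1 + c" c n] by (simp add: D_def algebra_simps)
  then have "pos (D * (1 + c) + real n *\<^sub>R (c * c))"
    using Suc assms unfolding D_def[symmetric]
    by (intro pos_add pos_mult pos_scaleR) auto
  moreover have "D * (1 + c) + real n *\<^sub>R (c * c) = (1 + c) ^ Suc n - 1 - real (Suc n) *\<^sub>R c"
    unfolding power_Suc2 by (simp add: D_def algebra_simps)
  ultimately show ?case by simp
qed simp

text \<open>Up to sign, \<open>a\<close> and \<open>b\<close> are twice the real and imaginary parts
  of \<open>z\<close>, and \<open>a * a + b * b\<close> is twice the given sum.\<close>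

lemma pos_star_mult_add_mult_star: "pos (star z * z + z * star z)"
proof -
  define a where "a = z + star z"
  define b where "b = scaleC \<i> (z - star z)"
  have a: "star a = a" by (simp add: a_def star_simps add.commute)
  have "scaleC (- \<i>) c = - scaleC \<i> c" for c :: 'a
    using scaleC_scaleC[of "- 1" \<i> c] by (simp add: scaleC_minus_one)
  moreover have "scaleC \<i> (- c) = - scaleC \<i> c" for c :: 'a
    using scaleC_scaleC[of \<i> "- 1" c] scaleC_scaleC[of "- 1" \<i> c] by (simp add: scaleC_minus_one)
  ultimately have b: "star b = b"
    unfolding b_def star_scaleC by (simp add: star_simps) (metis minus_diff_eq)
  have "b * b = - ((z - star z) * (z - star z))"
    by (simp add: b_def mult_scaleC_left mult_scaleC_right scaleC_scaleC scaleC_minus_one)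
  then have "a * a + b * b = 2 *\<^sub>R (star z * z + z * star z)"
    unfolding scaleR_2 by (simp add: a_def algebra_simps)
  then have "(1/2) *\<^sub>R (a * a + b * b) = star z * z + z * star z"
    by simp
  then show ?thesis
    using pos_scaleR[OF pos_add[OF pos_square[OF a] pos_square[OF b]], of "1/2"] by simp
qed

text \<open>
  If \<open>c = - star z * z\<close> is positive, so is \<open>e = z * star z\<close>.  Then \<open>norm (1 - e) \<le> 1\<close> makes
  \<open>star z * (1 - e) ^ n * z = - c * (1 + c) ^ n\<close> bounded in \<open>n\<close>, whereas it grows like \<open>n * c\<^sup>2\<close>.
\<close>

lemma eq_0_if_pos_minus_star_mult:
  assumes "pos (- (star z * z))"
  shows "z = 0"
proof (rule ccontr)
  assume "z \<noteq> 0"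
  \<comment> \<open>Normalising gives \<open>norm e \<le> 1\<close>, which keeps the powers of
    \<open>1 - e\<close> bounded, and \<open>norm c = 1\<close>, which yields the
    contradiction.\<close>
  define y where "y = (1 / norm z) *\<^sub>R z"
  define c where "c = - (star y * y)"
  define e where "e = y * star y"
  have y: "norm y = 1" using \<open>z \<noteq> 0\<close> by (simp add: y_def)
  have c: "pos c"
    using pos_scaleR[OF assms, of "(1 / norm z)\<^sup>2"]
    by (simp add: c_def y_def star_simps power2_eq_square)
  \<comment> \<open>\<open>e\<close> is the sum of \<open>star y * y + y * star y\<close> and
    \<open>c\<close>.\<close>
  have "pos e"
    using pos_add[OF pos_star_mult_add_mult_star[of y] c] by (simp add: c_def e_def)
  moreover have "norm e \<le> 1"
    using norm_mult_ineq[of y "star y"] by (simp add: e_def y)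
  ultimately have ne: "norm (1 - e) \<le> 1"
    using pos_norm_diff_le[of e 1] by simp
  have intertwine: "(1 - e) ^ n * y = y * (1 + c) ^ n" for n
  proof (induction n)
    case (Suc n)
    have "(1 - e) ^ Suc n * y = (1 - e) * (y * (1 + c) ^ n)"
      by (simp add: mult.assoc Suc)
    also have "\<dots> = y * (1 + c) ^ Suc n"
      by (simp add: e_def c_def algebra_simps)
    finally show ?case .
  qed simp
  have bound: "norm (c * (1 + c) ^ n) \<le> 1" for n
  proof -
    have "c * (1 + c) ^ n = - (star y * ((1 - e) ^ n * y))"
      by (simp add: intertwine c_def mult.assoc)
    also have "norm \<dots> \<le> norm (star y) * (norm ((1 - e) ^ n) * norm y)"
      unfolding norm_minus_cancel
      by (intro order.trans[OF norm_mult_ineq] mult_left_mono norm_mult_ineq) simp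
    also have "\<dots> \<le> 1"
      using norm_power_ineq[of "1 - e" n] power_le_one[OF norm_ge_zero ne, of n] by (simp add: y)
    finally show ?thesis .
  qed
  \<comment> \<open>\<open>1 - n * c\<^sup>2\<close> is the sum of the positive elements
    \<open>1 - c * (1 + c) ^ n\<close>, \<open>c * D\<close> and \<open>c\<close>. Already
    \<open>n = 2\<close> is too large for \<open>norm c = 1\<close>.\<close>
  have "real n * (norm c)\<^sup>2 \<le> 1" for n
  proof -
    define D where "D = (1 + c) ^ n - 1 - real n *\<^sub>R c"
    have comm: "c * (1 + c) ^ n = (1 + c) ^ n * c"
      by (rule power_commuting_commutes[symmetric]) (simp add: algebra_simps)
    have "pos (c * D)"
      using pos_mult[OF c pos_one_plus_power_diff[OF c, of n]] comm
      by (simp add: D_def algebra_simps)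
    moreover have "pos (of_real 1 - c * (1 + c) ^ n)"
      by (rule pos_of_norm_le[OF _ bound]) (simp add: star_simps pos_selfadjoint[OF c] comm)
    ultimately have "pos ((of_real 1 - c * (1 + c) ^ n) + c * D + c)"
      using c by (intro pos_add)
    then have "pos (of_real 1 - real n *\<^sub>R (c * c))"
      by (simp add: D_def algebra_simps)
    then have "norm (real n *\<^sub>R (c * c)) \<le> 1"
      by (intro pos_norm_le pos_scaleR pos_square pos_selfadjoint[OF c]) auto
    then show ?thesis
      using norm_selfadjoint_square[OF pos_selfadjoint[OF c]] by simp
  qed
  moreover have "norm c = 1"
    using norm_star_mult[of y] by (simp add: c_def y)
  ultimately show False
    using \<open>\<And>n. real n * (norm c)\<^sup>2 \<le> 1\<close>[of 2] by simp
qed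

text \<open>
  With \<open>k\<close> the absolute value of \<open>h = star y * y\<close> and \<open>m = k - h\<close> twice its negative part, the
  element \<open>z = y * m\<close> has \<open>star z * z = - m * k * m\<close>.
\<close>

lemma pos_star_mult: "pos (star y * y)"
proof -
  define h where "h = star y * y"
  have h: "star h = h" by (simp add: h_def star_simps)
  obtain k where k: "pos k" "k * k = h * h" "\<And>b. b * (h * h) = (h * h) * b \<Longrightarrow> b * k = k * b"
    using ex_pos_sqrt[OF pos_square[OF h]] by metis
  have hk: "h * k = k * h" by (rule k(3)) (simp add: mult.assoc)
  obtain r where r: "star r = r" "r * r = k" "\<And>b. b * k = k * b \<Longrightarrow> b * r = r * b"
    using ex_pos_sqrt[OF k(1)] by metis
  define m where "m = k - h"
  have m: "star m = m" by (simp add: m_def star_simps h pos_selfadjoint[OF k(1)])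
  have mk: "m * k = k * m" by (simp add: m_def algebra_simps hk)
  have mr: "m * r = r * m" by (rule r(3)) (rule mk)
  have hm: "h * m = - (k * m)" by (simp add: m_def algebra_simps hk k(2))
  have "star (m * r) = m * r" by (simp add: star_simps m r mr)
  moreover have "(m * r) * (m * r) = m * k * m"
    by (metis mr r(2) mult.assoc)
  ultimately have "pos (m * k * m)" using pos_square by metis
  moreover have "star (y * m) * (y * m) = m * (h * m)"
    by (simp add: star_simps m h_def mult.assoc)
  ultimately have "y * m = 0"
    by (intro eq_0_if_pos_minus_star_mult) (simp add: hm mult.assoc)
  then have "h * m = 0" by (simp add: h_def mult.assoc)
  then have "m * m = k * m" and km: "k * m = 0" 
    using hm by (simp_all add: m_def algebra_simps)
  then have "m * m = 0" by simp
  then have "m = 0" by (rule selfadjoint_square_eq_0D[OF m])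
  then show ?thesis using k(1) by (simp add: m_def h_def)
qed

lemma pos_conj:
  assumes "pos h"
  shows "pos (star y * h * y)"
proof -
  obtain s where "star s = s" "h = s * s" using assms unfolding pos_def by blast
  then show ?thesis using pos_star_mult[of "s * y"] by (simp add: star_simps mult.assoc)
qed

lemma norm_le_of_pos_diff:
  assumes "pos (of_real C - star y * y)" "0 \<le> C"
  shows "(norm y)\<^sup>2 \<le> C"
  using pos_norm_le[OF pos_star_mult assms] by (simp add: norm_star_mult)

lemma pos_diff_of_norm_le:
  assumes "norm y \<le> C"
  shows "pos (of_real (C\<^sup>2) - star y * y)"
  by (rule pos_of_norm_le) (use assms in \<open>simp_all add: star_simps norm_star_mult power_mono\<close>)

section \<open>Extreme points of the unit ball\<close>

lemma extreme_point_perturbation: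
  fixes x :: "'a::real_normed_vector"
  assumes "x extreme_point_of cball 0 1" "norm (x + d) \<le> 1" "norm (x - d) \<le> 1"
  shows "d = 0"
proof (rule ccontr)
  assume "d \<noteq> 0"
  have "x = (1 - 1/2) *\<^sub>R (x + d) + (1/2) *\<^sub>R (x - d)"
    by (simp add: algebra_simps flip: scaleR_add_left)
  moreover have "x + d \<noteq> x - d"
  proof
    assume "x + d = x - d"
    then have "2 *\<^sub>R d = 0" by (simp add: scaleR_2 algebra_simps)
    then show False using \<open>d \<noteq> 0\<close> by simp
  qed
  ultimately have "x \<in> open_segment (x + d) (x - d)"
    unfolding in_segment by (intro conjI exI[where x = "1/2"]) auto
  then show False
    using assms unfolding extreme_point_of_def by auto
qed

text \<open>
  For \<open>h = star x * x\<close> and \<open>v = 1 - h\<close>, the element \<open>x + c * x * v\<close> stays in the unit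
  ball for small \<open>c\<close> of either sign, since \<open>t * (1 + c * (1 - t))\<^sup>2 \<le> 1\<close> for \<open>0 \<le> t \<le> 1\<close>.
\<close>

lemma extreme_point_partial_isometry:
  fixes x :: "'a::unital_cstar_algebra"
  assumes ext: "x extreme_point_of cball 0 1"
  shows "x * star x * x = x"
proof -
  define h where "h = star x * x"
  define v where "v = 1 - h"
  have x: "norm x \<le> 1" using ext by (simp add: extreme_point_of_def)
  have h: "star h = h" by (simp add: h_def star_simps)
  have nh: "norm h \<le> 1" using x by (simp add: h_def norm_star_mult power_le_one)
  have v: "pos v"
    using pos_diff_of_norm_le[OF x] by (simp add: v_def h_def)
  have nv: "norm v \<le> 1"
    using pos_norm_diff_le[of h 1] pos_star_mult[of x] nh by (simp add: v_def flip: h_def)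
  \<comment> \<open>\<open>1 - star y * y\<close> factors as \<open>v * (1 - R)\<close>, and 1/4 is
    small enough for
    \<open>norm R \<le> \<bar>c\<bar> * (2 + \<bar>c\<bar>) \<le> 1\<close>.\<close>
  have "norm (x + c *\<^sub>R (x * v)) \<le> 1" if c: "\<bar>c\<bar> = 1/4" for c :: real
  proof -
    define y where "y = x + c *\<^sub>R (x * v)"
    define R where "R = (2 * c) *\<^sub>R h + (c * c) *\<^sub>R (h * v)"
    have "norm (h * v) \<le> norm h * norm v" by (rule norm_mult_ineq)
    also have "\<dots> \<le> 1" using nh nv by (simp add: mult_le_one)
    finally have "norm (h * v) \<le> 1" .
    have hv: "h * v = v * h" by (simp add: v_def algebra_simps)
    have "norm R \<le> norm ((2 * c) *\<^sub>R h) + norm ((c * c) *\<^sub>R (h * v))"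
      unfolding R_def by (rule norm_triangle_ineq)
    also have "\<dots> = \<bar>c\<bar> * (2 * norm h + \<bar>c\<bar> * norm (h * v))"
      by (simp add: abs_mult algebra_simps)
    also have "\<dots> \<le> 1" using nh \<open>norm (h * v) \<le> 1\<close> unfolding c by simp
    finally have "norm R \<le> 1" .
    moreover have "star R = R"
      by (simp add: R_def star_simps h pos_selfadjoint[OF v] hv)
    ultimately have "pos (of_real 1 - R)" by (rule pos_of_norm_le[rotated])
    moreover have "v * R = R * v"
      unfolding R_def v_def by (simp add: algebra_simps)
    ultimately have "pos (v * (1 - R))"
      by (intro pos_mult v) (simp_all add: algebra_simps)
    moreover have "v * (1 - R) = 1 - star y * y"
    proof -
      have "star y * y = (1 + c *\<^sub>R v) * h * (1 + c *\<^sub>R v)"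
        by (simp add: y_def h_def star_simps pos_selfadjoint[OF v] algebra_simps)
      then show ?thesis
        by (simp add: R_def v_def algebra_simps flip: scaleR_add_left)
    qed
    ultimately have "(norm y)\<^sup>2 \<le> 1"
      using norm_le_of_pos_diff[of 1 y] by simp
    then show ?thesis by (simp add: y_def power_le_one_iff)
  qed
  from this[of "1/4"] this[of "- 1/4"] have "(1/4) *\<^sub>R (x * v) = 0"
    by (intro extreme_point_perturbation[OF ext]) simp_all
  then show ?thesis by (simp add: v_def h_def algebra_simps)
qed

text \<open>For \<open>d\<close> in this corner, \<open>d * p = 0\<close> and
  \<open>star x * d = 0\<close> remove the mixed terms, so \<open>x + d\<close> and
  \<open>x - d\<close> both have square modulus \<open>p + star d * d\<close>. If
  \<open>norm d \<le> 1\<close> this is at most 1, and extremality forces \<open>d = 0\<close>;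
  scaling covers the other \<open>d\<close>.\<close>

lemma extreme_point_corner:
  fixes x :: "'a::unital_cstar_algebra"
  assumes ext: "x extreme_point_of cball 0 1"
  shows "(1 - x * star x) * b * (1 - star x * x) = 0"
proof -
  define p where "p = star x * x"
  have xp: "x * p = x"
    using extreme_point_partial_isometry[OF ext] by (simp add: p_def mult.assoc)
  have p: "star p = p" by (simp add: p_def star_simps)
  have pp: "p * p = p" using xp by (simp add: p_def mult.assoc)
  have corner: "d = 0" if dp: "d * p = 0" and xd: "star x * d = 0" and d: "norm d \<le> 1" for d
  proof -
    have sd: "p * star d = 0" "star d * x = 0"
      using arg_cong[OF dp, of star] arg_cong[OF xd, of star] by (simp_all add: star_simps p)
    have ball: "norm (x + r *\<^sub>R d) \<le> 1" if r: "r * r = 1" for r :: real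
    proof -
      have "star (x + r *\<^sub>R d) * (x + r *\<^sub>R d) = p + (r * r) *\<^sub>R (star d * d)"
        by (simp add: star_add star_scaleR distrib_left distrib_right sd xd p_def)
      also have "\<dots> = 1 - (1 - p) * (1 - star d * d) * (1 - p)"
      proof -
        have "star d * d * p = 0" "p * (star d * d) = 0"
          by (simp_all add: mult.assoc dp) (simp add: sd flip: mult.assoc)
        then show ?thesis
          by (simp add: left_diff_distrib right_diff_distrib pp mult.assoc r)
      qed
      finally have "of_real 1 - star (x + r *\<^sub>R d) * (x + r *\<^sub>R d)
          = star (1 - p) * (of_real (1\<^sup>2) - star d * d) * (1 - p)"
        by (simp add: star_diff p)
      then have "pos (of_real 1 - star (x + r *\<^sub>R d) * (x + r *\<^sub>R d))"
        using pos_conj[OF pos_diff_of_norm_le[OF d]] by metis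
      then have "(norm (x + r *\<^sub>R d))\<^sup>2 \<le> 1" by (rule norm_le_of_pos_diff) simp
      then show ?thesis by (simp add: power_le_one_iff)
    qed
    show "d = 0"
      using extreme_point_perturbation[OF ext, of d] ball[of 1] ball[of "- 1"] by simp
  qed
  define d where "d = (1 - x * star x) * b * (1 - p)"
  have "star x * x * star x = star x"
    using arg_cong[OF extreme_point_partial_isometry[OF ext], of star]
    by (simp add: star_simps mult.assoc)
  then have xd: "star x * d = 0"
    by (simp add: d_def right_diff_distrib flip: mult.assoc)
  have dp: "d * p = 0"
    by (simp add: d_def mult.assoc left_diff_distrib pp)
  show ?thesis
  proof (cases "d = 0")
    case False
    have "(1 / norm d) *\<^sub>R d = 0"
      by (rule corner) (use False in \<open>simp_all add: dp xd\<close>)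
    then show ?thesis using False by simp
  qed (simp add: d_def p_def)
qed

section \<open>Closed ideals\<close>

text \<open>By induction, \<open>1 - (1 - k) ^ m * (1 + m k)\<close> is positive.\<close>

lemma norm_mult_one_minus_power_le:
  assumes k: "pos k" "norm k \<le> 1"
  shows "real (Suc m) * norm (k * (1 - k) ^ m) \<le> 1"
proof -
  define v where "v = 1 - k"
  have v: "pos v"
    using pos_of_norm_le[OF pos_selfadjoint[OF k(1)], of 1] k(2) by (simp add: v_def)
  have kv: "k * v ^ n = v ^ n * k" for n
    using power_commuting_commutes[of v k n] by (simp add: v_def algebra_simps)
  have F: "pos (1 - v ^ n * (1 + real n *\<^sub>R k))" for n
  proof (induction n)
    case (Suc n)
    have "pos (v ^ n * (real (Suc n) *\<^sub>R (k * k)))"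
    proof (rule pos_mult[OF pos_power[OF v]])
      show "pos (real (Suc n) *\<^sub>R (k * k))"
        by (intro pos_scaleR pos_square pos_selfadjoint k) simp
      show "v ^ n * (real (Suc n) *\<^sub>R (k * k)) = real (Suc n) *\<^sub>R (k * k) * v ^ n"
        by (simp add: mult.assoc kv) (simp add: kv flip: mult.assoc)
    qed
    moreover have "v * (1 + real (Suc n) *\<^sub>R k) = (1 + real n *\<^sub>R k) - real (Suc n) *\<^sub>R (k * k)"
      by (simp add: v_def algebra_simps)
    then have "v ^ Suc n * (1 + real (Suc n) *\<^sub>R k)
        = v ^ n * (1 + real n *\<^sub>R k) - v ^ n * (real (Suc n) *\<^sub>R (k * k))"
      by (simp only: power_Suc2 mult.assoc right_diff_distrib)
    then have "1 - v ^ Suc n * (1 + real (Suc n) *\<^sub>R k)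
        = (1 - v ^ n * (1 + real n *\<^sub>R k)) + v ^ n * (real (Suc n) *\<^sub>R (k * k))"
      by simp
    ultimately show ?case
      using pos_add[OF Suc] by metis
  qed simp
  \<comment> \<open>Since \<open>v = 1 - k\<close>, adding \<open>v ^ Suc m\<close> replaces the
    factor \<open>1 + m * k\<close> by \<open>(m + 1) * k\<close>.\<close>
  have "1 - v ^ m * (1 + real m *\<^sub>R k) + v ^ Suc m = of_real 1 - real (Suc m) *\<^sub>R (k * v ^ m)"
    unfolding power_Suc2 by (simp add: v_def[symmetric] kv distrib_left algebra_simps)
      (simp add: v_def algebra_simps)
  then have "pos (of_real 1 - real (Suc m) *\<^sub>R (k * v ^ m))"
    using pos_add[OF F[of m] pos_power[OF v, of "Suc m"]] by metis
  moreover have "pos (real (Suc m) *\<^sub>R (k * v ^ m))"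
    by (intro pos_scaleR pos_mult pos_power v k kv) simp
  ultimately have "norm (real (Suc m) *\<^sub>R (k * v ^ m)) \<le> 1"
    by (intro pos_norm_le) simp_all
  then show ?thesis by (simp add: v_def)
qed

section \<open>Cosets, approximate units and order inequalities modulo an ideal\<close>

context
  fixes I :: "'a::unital_cstar_algebra set"
  assumes I: "two_sided_ideal I"
begin

lemma ideal_zero: "0 \<in> I"
  and ideal_add: "a \<in> I \<Longrightarrow> b \<in> I \<Longrightarrow> a + b \<in> I"
  and ideal_mult_left: "a \<in> I \<Longrightarrow> r * a \<in> I"
  and ideal_mult_right: "a \<in> I \<Longrightarrow> a * r \<in> I"
  and ideal_scaleC: "a \<in> I \<Longrightarrow> scaleC c a \<in> I"
  using I unfolding two_sided_ideal_def by blast+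

lemmas ideal_diff = two_sided_ideal_diff[OF I]

lemma ideal_scaleR: "a \<in> I \<Longrightarrow> r *\<^sub>R a \<in> I"
  using ideal_scaleC[of a "of_real r"] by (simp add: scaleC_of_real)

lemma ideal_minus_iff: "- a \<in> I \<longleftrightarrow> a \<in> I"
  using ideal_scaleR[of a "- 1"] ideal_scaleR[of "- a" "- 1"] by auto

lemma infdist_ideal_cong: "a - b \<in> I \<Longrightarrow> infdist a I = infdist b I"
  using coset_eq_iff[OF I] quotient_norm[OF I] by metis

lemma infdist_ideal_le: "a - b \<in> I \<Longrightarrow> infdist a I \<le> norm b"
  using infdist_ideal_cong[of a b] infdist_le[OF ideal_zero, of b] by simp

lemma ex_coset_norm_less:
  assumes "infdist a I < r"
  obtains b where "a - b \<in> I" "norm b < r"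
proof -
  have "(INF i\<in>I. dist a i) < r"
    using assms ideal_zero by (auto simp: infdist_def split: if_splits)
  then obtain i where "i \<in> I" "dist a i < r"
    using cINF_less_iff[of I "dist a" r] ideal_zero by (auto intro: bdd_belowI2[where m = 0])
  then show ?thesis using that[of "a - i"] by (simp add: dist_norm)
qed

text \<open>Here \<open>g = (1 - k) ^ n\<close> is the complement of an approximate unit: congruent
  to 1 modulo \<open>I\<close>, yet almost annihilating \<open>K\<close>. With
  \<open>K = S * k\<close> the bound is \<open>S / (2 * n + 1)\<close>; the summand 1 in
  \<open>S\<close> keeps \<open>S\<close> positive when \<open>K = 0\<close>.\<close>

lemma ex_approximate_unit:
  assumes K: "pos K" "K \<in> I" and e: "0 < e"
  obtains g where "star g = g" "norm g \<le> 1" "1 - g \<in> I" "norm (g * K * g) \<le> e"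
    "\<And>b. b * K = K * b \<Longrightarrow> b * g = g * b"
proof -
  define S where "S = norm K + 1"
  define k where "k = (1 / S) *\<^sub>R K"
  define v where "v = 1 - k"
  have S: "S > 0" by (simp add: S_def add_nonneg_pos)
  have k: "pos k" using K S by (simp add: k_def pos_scaleR)
  have nk: "norm k \<le> 1" using S by (simp add: k_def S_def)
  have kI: "k \<in> I" using K(2) by (simp add: k_def ideal_scaleR)
  have v: "star v = v" by (simp add: v_def star_simps pos_selfadjoint[OF k])
  have nv: "norm v \<le> 1" using pos_norm_diff_le[OF k nk] by (simp add: v_def)
  obtain n :: nat where n: "S / e < real n" using reals_Archimedean2 by blast
  show ?thesis
  proof (rule that[of "v ^ n"])
    show "star (v ^ n) = v ^ n" by (simp add: star_simps v)
    show "norm (v ^ n) \<le> 1"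
      using norm_power_ineq[of v n] power_le_one[OF norm_ge_zero nv, of n] by linarith
    show "1 - v ^ n \<in> I"
    proof (induction n)
      case (Suc n)
      have "(1 - v ^ n) + v ^ n * k \<in> I" by (intro ideal_add Suc ideal_mult_left kI)
      moreover have "1 - v ^ Suc n = (1 - v ^ n) + v ^ n * k"
        unfolding power_Suc2 by (simp add: v_def right_diff_distrib)
      ultimately show ?case by (simp only:)
    qed (simp add: ideal_zero)
    show comm: "b * v ^ n = v ^ n * b" if "b * K = K * b" for b
      by (rule power_commuting_commutes[symmetric])
        (use that in \<open>simp add: v_def k_def algebra_simps\<close>)
    have "v ^ n * K * v ^ n = S *\<^sub>R (k * v ^ (n + n))"
      using S comm[of K] by (simp add: k_def power_add flip: mult.assoc)
    then have "real (Suc (n + n)) * norm (v ^ n * K * v ^ n) \<le> S"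
      using norm_mult_one_minus_power_le[OF k nk, of "n + n"] S
      by (simp add: v_def)
    moreover have "S < real (Suc (n + n)) * e"
    proof -
      have "S < real n * e" using n e by (simp add: divide_less_eq)
      also have "\<dots> \<le> real (Suc (n + n)) * e" using e by simp
      finally show ?thesis .
    qed
    ultimately have "real (Suc (n + n)) * norm (v ^ n * K * v ^ n) \<le> real (Suc (n + n)) * e"
      by (rule order.strict_implies_order[OF order.strict_trans1])
    then show "norm (v ^ n * K * v ^ n) \<le> e"
      by (rule mult_left_le_imp_le) simp
  qed
qed

text \<open>Conjugating the order inequality by a \<open>g\<close> that almost kills
  \<open>j\<close> gives \<open>(norm (y * g))\<^sup>2 \<le> d + e\<close>, and \<open>y * g\<close>
  represents the coset of \<open>y\<close>.\<close>

lemma infdist_sq_le_of_pos_diff: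
  assumes p: "pos (of_real d - j - star y * y)" and j: "j \<in> I" and d: "0 \<le> d"
  shows "(infdist y I)\<^sup>2 \<le> d"
proof (rule field_le_epsilon)
  fix e :: real assume e: "0 < e"
  have "star (of_real d - j - star y * y) = of_real d - j - star y * y"
    by (rule pos_selfadjoint[OF p])
  then have sj: "star j = j" by (simp add: star_simps of_real_def)
  \<comment> \<open>\<open>j\<close> is only known to be self-adjoint, so \<open>g\<close> is chosen
    for the positive \<open>j * j\<close>; the C*-identity turns this into a bound on
    \<open>j * g\<close>.\<close>
  obtain g where g: "star g = g" "norm g \<le> 1" "1 - g \<in> I" "norm (g * (j * j) * g) \<le> e\<^sup>2"
      "\<And>b. b * (j * j) = (j * j) * b \<Longrightarrow> b * g = g * b"
    using ex_approximate_unit[OF pos_square[OF sj] ideal_mult_left[OF j]] e by (metis zero_less_power)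
  have "(norm (j * g))\<^sup>2 \<le> e\<^sup>2"
    using g(4) norm_star_mult[of "j * g"] by (simp add: star_simps sj g(1) mult.assoc)
  then have njg: "norm (j * g) \<le> e" by (rule power2_le_imp_le) (use e in simp)
  have "norm (g * j * g) \<le> norm g * norm (j * g)"
    using norm_mult_ineq[of g "j * g"] by (simp add: mult.assoc)
  also have "\<dots> \<le> 1 * e" by (intro mult_mono g njg) simp_all
  finally have "pos (of_real e - - (g * j * g))"
    by (intro pos_of_norm_le) (simp_all add: star_simps sj g(1) mult.assoc)
  moreover have "pos (d *\<^sub>R (of_real (1\<^sup>2) - star g * g))"
    by (intro pos_scaleR pos_diff_of_norm_le g d)
  moreover have "pos (star g * (of_real d - j - star y * y) * g)"
    by (rule pos_conj[OF p])
  ultimately have "pos ((of_real e - - (g * j * g)) + d *\<^sub>R (of_real (1\<^sup>2) - star g * g)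
      + star g * (of_real d - j - star y * y) * g)"
    by (intro pos_add)
  also have "(of_real e - - (g * j * g)) + d *\<^sub>R (of_real (1\<^sup>2) - star g * g)
      + star g * (of_real d - j - star y * y) * g = of_real (d + e) - star (y * g) * (y * g)"
    by (simp add: g(1) star_mult of_real_def algebra_simps)
  finally have "(norm (y * g))\<^sup>2 \<le> d + e"
    by (rule norm_le_of_pos_diff) (use d e in simp)
  moreover have "y - y * g \<in> I"
    using ideal_mult_left[OF g(3), of y] by (simp add: right_diff_distrib)
  then have "(infdist y I)\<^sup>2 \<le> (norm (y * g))\<^sup>2"
    by (intro power_mono infdist_ideal_le infdist_nonneg)
  ultimately show "(infdist y I)\<^sup>2 \<le> d + e" by simp
qed

context
  assumes cl: "closed I"
begin

section \<open>Self-adjointness and rigidity for closed ideals\<close>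

lemma mem_ideal_iff_infdist: "a \<in> I \<longleftrightarrow> infdist a I = 0"
  using in_closed_iff_infdist_zero[OF cl] ideal_zero by blast

text \<open>The positive element \<open>a * star a\<close> lies in \<open>I\<close>. If
  \<open>g\<close> almost kills it, then \<open>star a * g\<close> is small by the C*-identity and
  represents the coset of \<open>star a\<close>; closedness concludes.\<close>

lemma star_mem_ideal:
  assumes "a \<in> I"
  shows "star a \<in> I"
proof -
  have "infdist (star a) I \<le> 0 + e" if e: "0 < e" for e :: real
  proof -
    have "pos (a * star a)" using pos_star_mult[of "star a"] by (simp add: star_star)
    then obtain g where g: "star g = g" "1 - g \<in> I" "norm (g * (a * star a) * g) \<le> e\<^sup>2"
      using ex_approximate_unit[OF _ ideal_mult_right[OF assms]] e by (metis zero_less_power)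
    have "(norm (star a * g))\<^sup>2 \<le> e\<^sup>2"
      using g(3) norm_star_mult[of "star a * g"] by (simp add: star_simps g(1) mult.assoc)
    then have "norm (star a * g) \<le> e" by (rule power2_le_imp_le) (use e in simp)
    moreover have "star a - star a * g \<in> I"
      using ideal_mult_left[OF g(2), of "star a"] by (simp add: right_diff_distrib)
    ultimately show ?thesis using infdist_ideal_le by fastforce
  qed
  then have "infdist (star a) I \<le> 0" by (rule field_le_epsilon)
  then show ?thesis
    using infdist_nonneg[of "star a" I] by (simp add: mem_ideal_iff_infdist)
qed

lemma infdist_star_le: "infdist (star a) I \<le> infdist a I"
proof (rule dense_ge)
  fix r assume "infdist a I < r"
  then obtain b where b: "a - b \<in> I" "norm b < r" by (rule ex_coset_norm_less)
  then show "infdist (star a) I \<le> r"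
    using infdist_ideal_le[of "star a" "star b"] star_mem_ideal[OF b(1)] by (simp add: star_diff)
qed

text \<open>
  For \<open>m = (1 - t) a + t b\<close> and \<open>d = a - b\<close> one has
  \<open>(1 - t) star a * a + t star b * b = star m * m + t (1 - t) star d * d\<close>.  If \<open>a\<close> and \<open>b\<close> are
  representatives of norm at most \<open>1 + e\<close>, compressing to \<open>p\<close> bounds \<open>t (1 - t) star (d p) * (d p)\<close>
  by \<open>(1 + e)\<^sup>2 - 1\<close> modulo \<open>I\<close>.
\<close>

lemma convex_combination_right_support:
  assumes xp: "x * star x * x = x"
    and t: "0 < t" "t < 1"
    and ab: "infdist a I \<le> 1" "infdist b I \<le> 1"
    and eq: "x - ((1 - t) *\<^sub>R a + t *\<^sub>R b) \<in> I"
  shows "(a - b) * (star x * x) \<in> I"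
proof -
  define p where "p = star x * x"
  define c where "c = sqrt (t * (1 - t))"
  have cc: "c * c = t * (1 - t)" and c: "c > 0" using t by (simp_all add: c_def)
  have p: "star p = p" by (simp add: p_def star_simps)
  have pp: "p * p = p" using xp by (simp add: p_def mult.assoc)
  \<comment> \<open>\<open>Y\<close> does not depend on \<open>e\<close>: the representatives chosen
    below enter only through \<open>y\<close>, congruent to \<open>Y\<close>, so \<open>e\<close>
    can tend to 0. The factor \<open>c\<close> absorbs the weight
    \<open>t * (1 - t)\<close>.\<close>
  define Y where "Y = c *\<^sub>R ((a - b) * p)"
  have est: "(infdist Y I)\<^sup>2 \<le> (1 + e)\<^sup>2 - 1" if e: "0 < e" for e :: real
  proof -
    obtain a' where a': "a - a' \<in> I" "norm a' < 1 + e"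
      using ex_coset_norm_less[of a "1 + e"] ab e by auto
    obtain b' where b': "b - b' \<in> I" "norm b' < 1 + e"
      using ex_coset_norm_less[of b "1 + e"] ab e by auto
    define m where "m = (1 - t) *\<^sub>R a' + t *\<^sub>R b'"
    define d where "d = a' - b'"
    define J where "J = star m * m - star x * x"
    define C where "C = (1 + e)\<^sup>2"
    define y where "y = c *\<^sub>R (d * p)"
    have "(x - ((1 - t) *\<^sub>R a + t *\<^sub>R b)) + ((1 - t) *\<^sub>R (a - a') + t *\<^sub>R (b - b')) \<in> I"
      by (intro ideal_add ideal_scaleR eq a' b')
    moreover have "(x - ((1 - t) *\<^sub>R a + t *\<^sub>R b)) + ((1 - t) *\<^sub>R (a - a') + t *\<^sub>R (b - b')) = x - m"
      by (simp add: m_def scaleR_right_diff_distrib)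
    ultimately have xm: "x - m \<in> I" by metis
    \<comment> \<open>Since \<open>I\<close> is closed under \<open>star\<close>, congruence of
      \<open>x\<close> and \<open>m\<close> passes to \<open>star x * x\<close> and
      \<open>star m * m\<close>.\<close>
    have "star (x - m) * m + star x * (x - m) \<in> I"
      by (intro ideal_add ideal_mult_left ideal_mult_right star_mem_ideal xm)
    moreover have "star (x - m) * m + star x * (x - m) = - J"
      by (simp add: J_def star_diff algebra_simps)
    ultimately have J: "J \<in> I"
      by (simp only: ideal_minus_iff)
    have C: "C \<ge> 1" using e by (simp add: C_def one_le_power)
    have "star m * m + (t * (1 - t)) *\<^sub>R (star d * d)
        = (1 - t) *\<^sub>R (star a' * a') + t *\<^sub>R (star b' * b')"
      by (simp add: m_def d_def star_simps algebra_simps)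
    then have split: "of_real C - star x * x - J - (c * c) *\<^sub>R (star d * d)
        = (1 - t) *\<^sub>R (of_real C - star a' * a') + t *\<^sub>R (of_real C - star b' * b')"
      by (simp add: J_def cc of_real_def algebra_simps)
    have "pos (of_real C - star x * x - J - (c * c) *\<^sub>R (star d * d))"
      unfolding split unfolding C_def
      by (intro pos_add pos_scaleR pos_diff_of_norm_le) (use a' b' t in simp_all)
    then have "pos (star p * (of_real C - star x * x - J - (c * c) *\<^sub>R (star d * d)) * p)"
      by (rule pos_conj)
    \<comment> \<open>Compression by \<open>p\<close> leaves the leading term
      \<open>(C - 1) * p\<close>; adding \<open>(C - 1) * (1 - p)\<close> makes it the scalar
      required by \<open>infdist_sq_le_of_pos_diff\<close>.\<close>
    moreover have "pos ((C - 1) *\<^sub>R (star (1 - p) * (1 - p)))"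
      by (intro pos_scaleR pos_star_mult) (use C in simp)
    ultimately have "pos (star p * (of_real C - star x * x - J - (c * c) *\<^sub>R (star d * d)) * p
        + (C - 1) *\<^sub>R (star (1 - p) * (1 - p)))"
      by (rule pos_add)
    also have "star p * (of_real C - star x * x - J - (c * c) *\<^sub>R (star d * d)) * p
        + (C - 1) *\<^sub>R (star (1 - p) * (1 - p)) = of_real (C - 1) - p * J * p - star y * y"
      unfolding p_def[symmetric]
      by (simp add: y_def star_mult star_diff star_scaleR p pp of_real_def left_diff_distrib
          right_diff_distrib scaleR_left_diff_distrib scaleR_right_diff_distrib mult.assoc)
    finally have "(infdist y I)\<^sup>2 \<le> C - 1"
      by (rule infdist_sq_le_of_pos_diff) (use C J in \<open>simp_all add: ideal_mult_left ideal_mult_right\<close>)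
    moreover have "Y - y = c *\<^sub>R (((a - a') - (b - b')) * p)"
      by (simp add: Y_def y_def d_def algebra_simps)
    then have "Y - y \<in> I"
      using a' b' by (simp add: ideal_scaleR ideal_mult_right ideal_diff)
    ultimately show ?thesis by (simp add: infdist_ideal_cong[of Y y] C_def)
  qed
  have "((\<lambda>e. (1 + e)\<^sup>2 - 1) \<longlongrightarrow> (1 + 0)\<^sup>2 - (1::real)) (at_right 0)"
    by (intro tendsto_intros)
  then have "(infdist Y I)\<^sup>2 \<le> (1 + 0)\<^sup>2 - 1"
    by (rule tendsto_lowerbound)
      (auto simp: eventually_at_filter intro!: always_eventually est)
  then have "Y \<in> I" by (simp add: mem_ideal_iff_infdist)
  then have "(1 / c) *\<^sub>R Y \<in> I" by (rule ideal_scaleR)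
  then show ?thesis using c by (simp add: Y_def p_def)
qed

text \<open>The previous lemma for \<open>x\<close> and for \<open>star x\<close> puts
  \<open>(a - b) * p\<close> and \<open>q * (a - b)\<close> into \<open>I\<close>. What remains of
  \<open>a - b\<close> is the corner \<open>(1 - q) * (a - b) * (1 - p)\<close>, which
  vanishes.\<close>

lemma convex_combination_eq_mod_ideal:
  assumes ext: "x extreme_point_of cball 0 1"
    and t: "0 < t" "t < 1"
    and ab: "infdist a I \<le> 1" "infdist b I \<le> 1"
    and eq: "x - ((1 - t) *\<^sub>R a + t *\<^sub>R b) \<in> I"
  shows "a - b \<in> I"
proof -
  define p where "p = star x * x"
  define q where "q = x * star x"
  have xp: "x * star x * x = x" by (rule extreme_point_partial_isometry[OF ext])
  have right: "(a - b) * p \<in> I"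
    unfolding p_def by (rule convex_combination_right_support[OF xp t ab eq])
  have "(star a - star b) * (star (star x) * star x) \<in> I"
  proof (rule convex_combination_right_support[OF _ t])
    show "star x * star (star x) * star x = star x"
      using arg_cong[OF xp, of star] by (simp add: star_simps mult.assoc)
    show "infdist (star a) I \<le> 1" "infdist (star b) I \<le> 1"
      using infdist_star_le[of a] infdist_star_le[of b] ab by simp_all
    show "star x - ((1 - t) *\<^sub>R star a + t *\<^sub>R star b) \<in> I"
      using star_mem_ideal[OF eq] by (simp add: star_simps)
  qed
  then have left: "q * (a - b) \<in> I"
    using star_mem_ideal[of "(star a - star b) * (star (star x) * star x)"]
    by (simp add: star_simps q_def)
  have "(1 - q) * (a - b) * (1 - p) = 0"
    unfolding p_def q_def by (rule extreme_point_corner[OF ext])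
  then have "a - b = q * (a - b) + (a - b) * p - q * ((a - b) * p)"
    by (simp add: left_diff_distrib right_diff_distrib mult.assoc) (simp add: algebra_simps)
  also have "\<dots> \<in> I"
    by (intro ideal_diff ideal_add left right ideal_mult_left)
  finally show ?thesis .
qed

text \<open>A representative \<open>y\<close> of norm below 1 makes the idempotent \<open>p\<close>
  congruent to the strict contraction \<open>w\<close>, hence to all its powers, so
  \<open>p \<in> I\<close>. Then \<open>x = x * p\<close> and \<open>q = x * star x\<close> lie in
  \<open>I\<close>, and the corner identity at 1 gives
  \<open>1 = q + p - q * p \<in> I\<close>.\<close>

lemma infdist_extreme_point:
  assumes ext: "x extreme_point_of cball 0 1" and proper: "I \<noteq> UNIV"
  shows "infdist x I = 1"
proof (rule ccontr)
  assume "infdist x I \<noteq> 1"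
  have x: "norm x \<le> 1" using ext by (simp add: extreme_point_of_def)
  have "infdist x I \<le> 1"
    using infdist_ideal_le[of x x] x ideal_zero by simp
  with \<open>infdist x I \<noteq> 1\<close> obtain y where y: "x - y \<in> I" "norm y < 1"
    using ex_coset_norm_less[of x 1] by auto
  define p where "p = star x * x"
  have xp: "x * p = x"
    using extreme_point_partial_isometry[OF ext] by (simp add: p_def mult.assoc)
  have pp: "p * p = p" using xp by (simp add: p_def mult.assoc)
  define w where "w = star x * y"
  have "norm w \<le> norm x * norm y" using norm_mult_ineq[of "star x" y] by (simp add: w_def)
  also have "\<dots> \<le> norm y" using x by (simp add: mult_left_le_one_le)
  finally have w: "norm w < 1" using y by simp
  have pw: "p - w \<in> I"
    using ideal_mult_left[OF y(1), of "star x"] by (simp add: p_def w_def right_diff_distrib)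
  have pwn: "p - w ^ Suc n \<in> I" for n
  proof (induction n)
    case (Suc n)
    have "p * (p - w) + (p - w ^ Suc n) * w \<in> I"
      by (intro ideal_add ideal_mult_left ideal_mult_right pw Suc)
    then show ?case
      unfolding power_Suc2[of w "Suc n"] by (simp add: left_diff_distrib right_diff_distrib pp)
  qed (simp add: pw)
  have "infdist p I \<le> norm w ^ Suc n" for n
    using infdist_ideal_le[OF pwn[of n]] norm_power_ineq[of w "Suc n"] by linarith
  moreover have "(\<lambda>n. norm w ^ Suc n) \<longlonglongrightarrow> 0"
    using LIMSEQ_Suc[OF LIMSEQ_power_zero[of "norm w"]] w by simp
  ultimately have "infdist p I \<le> 0"
    by (intro LIMSEQ_le_const) auto
  then have "p \<in> I" using infdist_nonneg[of p I] by (simp add: mem_ideal_iff_infdist)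
  then have "x \<in> I" using ideal_mult_left[of p x] by (simp add: xp)
  then have q: "x * star x \<in> I" by (rule ideal_mult_right)
  have "1 = x * star x + p - x * star x * p"
    using extreme_point_corner[OF ext, of 1] by (simp add: p_def[symmetric] algebra_simps)
  also have "\<dots> \<in> I"
    by (intro ideal_diff ideal_add q \<open>p \<in> I\<close> ideal_mult_left)
  finally have "r \<in> I" for r using ideal_mult_left[of 1 r] by simp
  then show False using proper by blast
qed

end

end

section \<open>Translation to the quotient algebra\<close>

theorem theorem2p4:
  fixes I :: "'a::unital_cstar_algebra set" and x :: 'a
  assumes "two_sided_ideal I" and "closed I" and "I \<noteq> {0}" and "I \<noteq> UNIV"
    and "x extreme_point_of cball 0 1"
  shows "infdist x I = 1 \<and>
    linear_extreme_point (quotient_alg I) (coset I x) (closed_unit_ball (quotient_alg I))"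
proof
  note I = assms(1) and cl = assms(2) and ext = assms(5)
  show dist: "infdist x I = 1"
    by (rule infdist_extreme_point[OF I cl ext assms(4)])
  have ball: "coset I a \<in> closed_unit_ball (quotient_alg I) \<longleftrightarrow> infdist a I \<le> 1" for a
    unfolding closed_unit_ball_def mem_Collect_eq quotient_norm[OF I]
    by (simp add: quotient_alg_def)
  have cosets: "\<exists>a. X = coset I a" if "X \<in> closed_unit_ball (quotient_alg I)" for X
    using that by (auto simp: closed_unit_ball_def quotient_alg_def)
  show "linear_extreme_point (quotient_alg I) (coset I x) (closed_unit_ball (quotient_alg I))"
    unfolding linear_extreme_point_def
  proof (intro conjI[OF _ ballI] ballI allI impI)
    show "coset I x \<in> closed_unit_ball (quotient_alg I)" by (simp add: ball dist)
    fix X Y and t :: real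
    assume X: "X \<in> closed_unit_ball (quotient_alg I)" and Y: "Y \<in> closed_unit_ball (quotient_alg I)"
      and t: "0 < t \<and> t < 1 \<and> coset I x = sa_add (quotient_alg I)
        (sa_scale (quotient_alg I) (complex_of_real (1 - t)) X)
        (sa_scale (quotient_alg I) (complex_of_real t) Y)"
    obtain a b where ab: "X = coset I a" "Y = coset I b" using cosets X Y by metis
    have eq: "x - ((1 - t) *\<^sub>R a + t *\<^sub>R b) \<in> I"
      using t unfolding ab quotient_scale[OF I] quotient_add[OF I] scaleC_of_real coset_eq_iff[OF I]
      by blast
    have d: "a - b \<in> I"
      by (rule convex_combination_eq_mod_ideal[OF I cl ext _ _ _ _ eq])
        (use t X Y in \<open>simp_all add: ab ball\<close>)
    \<comment> \<open>Both points must equal the coset of \<open>x\<close>, not just each other;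
      this combination collapses to \<open>a - x\<close>.\<close>
    have "t *\<^sub>R (a - b) - (x - ((1 - t) *\<^sub>R a + t *\<^sub>R b)) \<in> I"
      by (rule ideal_diff[OF I ideal_scaleR[OF I d] eq])
    then have "a - x \<in> I" by (simp add: algebra_simps)
    moreover from this have "(a - x) - (a - b) \<in> I"
      using d by (rule ideal_diff[OF I])
    then have "b - x \<in> I" by simp
    ultimately show "X = coset I x \<and> Y = coset I x"
      by (simp add: ab coset_eq_iff[OF I])
  qed
qed

end
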